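(* Consider the relaxation scheme (defined in the context). Suppose the initial data $(\omega_i^0)_{i\in\mathbb{Z}}$ satisfies, for all $i\in\mathbb{Z}$, $$u_i^0=u_{i+1}^0=0,\qquad \frac1{\Delta x}(p_{i+1}^0-p_i^0)+\bar\rho(W_i^0,W_{i+1}^0)\,\frac{\Phi_{i+1}-\Phi_i}{\Delta x}=0 .$$ Then the updated state $\omega^{n+1}$ stays at rest, i.e. $\omega_i^{n+1}=\omega_i^n$ for all $i\in\mathbb{Z}$ (and all $n\ge0$).
   Context: Model. One-dimensional dimensionless Euler equations with gravity, Mach number $M>0$, given smooth potential $\Phi$: $\partial_t\rho+\partial_x(\rho u)=0$, $\partial_t(\rho u)+\partial_x(\rho u^2+p/M^2)=-\frac{1}{M^2}\rho\,\partial_x\Phi$, $\partial_t E+\partial_x((E+p)u)=-\rho u\,\partial_x\Phi$, with $E=\rho e+\frac12M^2\rho u^2$, $\tau=1/\rho$, pressure law $p=p(\tau,e)$. Phase space $\Omega=\{\omega=(\rho,\rho u,E):\rho>0,e>0\}$; $F(\omega)=(\rho u,\rho u^2+p/M^2,(E+p)u)$. The data $\omega_i^0$ lie in $\Omega$. Approximate Riemann solver. Given $\omega^L,\omega^R\in\Omega$ and potential values $\Phi^L,\Phi^R$, put (relaxation equilibrium) $\pi^\alpha=p(\tau^\alpha,e^\alpha)$, $v^\alpha=u^\alpha$, $Z^\alpha=\Phi^\alpha$, $\alpha\in\{L,R\}$; a state is $W=(\rho,\rho u,E,\rho\pi,\rho v,\rho Z,a,b)$ and $W_i^n$ denotes the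 state built from $(\omega_i^n,\Phi_i)$ in this way. Relaxation speeds $a^\alpha\ge b^\alpha>0$ are given at each interface. $\bar\rho=\bar\rho(W^L,W^R)$ is a density average with $\bar\rho=\rho$ if $\rho^L=\rho^R=\rho$. With $\Delta=\bar\rho\,(Z^R-Z^L)$, the intermediate states are $v^*=\frac{Mb^Lv^L+Mb^Rv^R+\pi^L-\pi^R-\Delta}{M(b^L+b^R)}$, $\frac1{\rho^{L*}}=\frac1{\rho^L}+\frac{Mb^R(v^R-v^L)+\pi^L-\pi^R-\Delta}{a^L(b^L+b^R)}$, $\frac1{\rho^{R*}}=\frac1{\rho^R}+\frac{Mb^L(v^R-v^L)+\pi^R-\pi^L+\Delta}{a^R(b^L+b^R)}$, $u^{L*}=u^L+\frac{b^L(Mb^R(v^R-v^L)+\pi^L-\pi^R-\Delta)}{Ma^L(b^L+b^R)}$, $u^{R*}=u^R+\frac{b^R(Mb^L(v^L-v^R)+\pi^L-\pi^R-\Delta)}{Ma^R(b^L+b^R)}$, $\pi^{L*}=\frac{b^R\pi^L+b^L\pi^R+Mb^Lb^R(v^L-v^R)+b^L\Delta}{b^L+b^R}$, $\pi^{R*}=\frac{b^R\pi^L+b^L\pi^R+Mb^Lb^R(v^L-v^R)-b^R\Delta}{b^L+b^R}$, $e^{\alpha*}=e^\alpha+\frac{(\pi^{\alpha*})^2-(\pi^\alpha)^2}{2a^\alpha b^\alpha}+\frac{M^2[(v^*-u^{\alpha*})^2-(v^\alpha-u^\alpha)^2]}{2(a^\alpha/b^\alpha-1)}$ (last quotient read as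 $0$ if $a^\alpha=b^\alpha$), $E^{\alpha*}=\rho^{\alpha*}e^{\alpha*}+\frac12M^2\rho^{\alpha*}(u^{\alpha*})^2$. The wave speeds are $\sigma^-=v^L-\frac{a^L}{M\rho^L}$, $\sigma^v=v^*$, $\sigma^+=v^R+\frac{a^R}{M\rho^R}$. Relaxation scheme. Uniform grid with cells of size $\Delta x$ and time step $\Delta t$. The numerical flux $F(\omega^L,\Phi^L,\omega^R,\Phi^R)$ equals $F(\omega^L)$ if $\sigma^->0$; $F^{L*}$ if $\sigma^-<0\le\sigma^v$; $F^{R*}$ if $\sigma^v<0<\sigma^+$; $F(\omega^R)$ if $\sigma^+<0$, where $F^{\alpha*}=(\rho^{\alpha*}v^*,\rho^{\alpha*}u^{\alpha*}v^*+\pi^{\alpha*}/M^2,(E^{\alpha*}+\pi^{\alpha*})v^* )$. The numerical sources are $S^{+}=-(\mathrm{sgn}(v^* )+1)(0,\frac{\bar\rho}{M^2},\bar\rho v^* )^T$ and $S^{-}=(\mathrm{sgn}(v^* )-1)(0,\frac{\bar\rho}{M^2},\bar\rho v^* )^T$, with the convention $\mathrm{sgn}(0)=1$. The update is $\omega_i^{n+1}=\omega_i^n-\frac{\Delta t}{\Delta x}(F_{i+1/2}^n-F_{i-1/2}^n)+\frac{\Delta t}{2}\big(S_{i-1/2}^{+,n}\frac{\Phi_i-\Phi_{i-1}}{\Delta x}+S_{i+1/2}^{-,n}\frac{\Phi_{i+1}-\Phi_i}{\Delta x}\big)$, where a subscript $i+1/2$ means evaluation at left state $(\omega_i^n,\Phi_i)$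 and right state $(\omega_{i+1}^n,\Phi_{i+1})$. *)

theory Defs
  imports Complex_Main "HOL-Analysis.Product_Vector"
begin

text \<open>Conserved variables \<open>(\<rho>, \<rho>u, E)\<close>; sums and scalings are those of the product vector space.\<close>

type_synonym euler_state = "real \<times> real \<times> real"

definition dens :: "euler_state \<Rightarrow> real" where
  "dens w = fst w"

definition energy :: "euler_state \<Rightarrow> real" where
  "energy w = snd (snd w)"

definition vel :: "euler_state \<Rightarrow> real" where
  "vel w = fst (snd w) / dens w"

text \<open>The internal energy solves \<open>E = \<rho> e + M\<^sup>2 \<rho> u\<^sup>2 / 2\<close>.\<close>

definition int_energy :: "real \<Rightarrow> euler_state \<Rightarrow> real" where
  "int_energy M w = (energy w - M\<^sup>2 * dens w * (vel w)\<^sup>2 / 2) / dens w"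

definition phase_space :: "real \<Rightarrow> euler_state set" where
  "phase_space M = {w. dens w > 0 \<and> int_energy M w > 0}"

text \<open>Pressure laws \<open>p\<close> are functions of the specific volume \<open>\<tau> = 1 / \<rho>\<close> and of \<open>e\<close>.\<close>

definition pressure :: "real \<Rightarrow> (real \<Rightarrow> real \<Rightarrow> real) \<Rightarrow> euler_state \<Rightarrow> real" where
  "pressure M p w = p (1 / dens w) (int_energy M w)"

definition euler_flux :: "real \<Rightarrow> (real \<Rightarrow> real \<Rightarrow> real) \<Rightarrow> euler_state \<Rightarrow> euler_state" where
  "euler_flux M p w =
     (dens w * vel w,
      dens w * (vel w)\<^sup>2 + pressure M p w / M\<^sup>2,
      (energy w + pressure M p w) * vel w)"


text \<open>Relaxation states \<open>W = (\<rho>, \<rho>u, E, \<rho>\<pi>, \<rho>v, \<rho>Z, a, b)\<close> and their primitive variables.\<close>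

record relax_state =
  W_rho :: real
  W_rhou :: real
  W_E :: real
  W_rhopi :: real
  W_rhov :: real
  W_rhoZ :: real
  W_a :: real
  W_b :: real

definition W_u :: "relax_state \<Rightarrow> real" where
  "W_u W = W_rhou W / W_rho W"

definition W_pi :: "relax_state \<Rightarrow> real" where
  "W_pi W = W_rhopi W / W_rho W"

definition W_v :: "relax_state \<Rightarrow> real" where
  "W_v W = W_rhov W / W_rho W"

definition W_Z :: "relax_state \<Rightarrow> real" where
  "W_Z W = W_rhoZ W / W_rho W"

definition W_e :: "real \<Rightarrow> relax_state \<Rightarrow> real" where
  "W_e M W = int_energy M (W_rho W, W_rhou W, W_E W)"

definition equilibrium ::
  "real \<Rightarrow> (real \<Rightarrow> real \<Rightarrow> real) \<Rightarrow> euler_state \<Rightarrow> real \<Rightarrow> real \<Rightarrow> real \<Rightarrow> relax_state" where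
  "equilibrium M p w \<phi> a b =
     \<lparr>W_rho = dens w, W_rhou = dens w * vel w, W_E = energy w,
      W_rhopi = dens w * pressure M p w, W_rhov = dens w * vel w, W_rhoZ = dens w * \<phi>,
      W_a = a, W_b = b\<rparr>"

definition density_average :: "(relax_state \<Rightarrow> relax_state \<Rightarrow> real) \<Rightarrow> bool" where
  "density_average rbar \<longleftrightarrow>
     (\<forall>WL WR \<rho>. 0 < \<rho> \<and> W_rho WL = \<rho> \<and> W_rho WR = \<rho> \<longrightarrow> rbar WL WR = \<rho>)"


text \<open>Intermediate states of the Riemann solver; \<open>d\<close> is \<open>\<Delta> = \<rho>bar (Z\<^sup>R - Z\<^sup>L)\<close>.\<close>

definition gravity_jump ::
  "(relax_state \<Rightarrow> relax_state \<Rightarrow> real) \<Rightarrow> relax_state \<Rightarrow> relax_state \<Rightarrow> real" where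
  "gravity_jump rbar L R = rbar L R * (W_Z R - W_Z L)"

definition v_star :: "real \<Rightarrow> real \<Rightarrow> relax_state \<Rightarrow> relax_state \<Rightarrow> real" where
  "v_star M d L R =
     (M * W_b L * W_v L + M * W_b R * W_v R + W_pi L - W_pi R - d) / (M * (W_b L + W_b R))"

definition rho_L_star :: "real \<Rightarrow> real \<Rightarrow> relax_state \<Rightarrow> relax_state \<Rightarrow> real" where
  "rho_L_star M d L R =
     1 / (1 / W_rho L + (M * W_b R * (W_v R - W_v L) + W_pi L - W_pi R - d)
                          / (W_a L * (W_b L + W_b R)))"

definition rho_R_star :: "real \<Rightarrow> real \<Rightarrow> relax_state \<Rightarrow> relax_state \<Rightarrow> real" where
  "rho_R_star M d L R =
     1 / (1 / W_rho R + (M * W_b L * (W_v R - W_v L) + W_pi R - W_pi L + d)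
                          / (W_a R * (W_b L + W_b R)))"

definition u_L_star :: "real \<Rightarrow> real \<Rightarrow> relax_state \<Rightarrow> relax_state \<Rightarrow> real" where
  "u_L_star M d L R =
     W_u L + W_b L * (M * W_b R * (W_v R - W_v L) + W_pi L - W_pi R - d)
               / (M * W_a L * (W_b L + W_b R))"

definition u_R_star :: "real \<Rightarrow> real \<Rightarrow> relax_state \<Rightarrow> relax_state \<Rightarrow> real" where
  "u_R_star M d L R =
     W_u R + W_b R * (M * W_b L * (W_v L - W_v R) + W_pi L - W_pi R - d)
               / (M * W_a R * (W_b L + W_b R))"

definition pi_L_star :: "real \<Rightarrow> real \<Rightarrow> relax_state \<Rightarrow> relax_state \<Rightarrow> real" where
  "pi_L_star M d L R =
     (W_b R * W_pi L + W_b L * W_pi R + M * W_b L * W_b R * (W_v L - W_v R) + W_b L * d)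
       / (W_b L + W_b R)"

definition pi_R_star :: "real \<Rightarrow> real \<Rightarrow> relax_state \<Rightarrow> relax_state \<Rightarrow> real" where
  "pi_R_star M d L R =
     (W_b R * W_pi L + W_b L * W_pi R + M * W_b L * W_b R * (W_v L - W_v R) - W_b R * d)
       / (W_b L + W_b R)"

text \<open>\<open>W\<close> is the outer state on the side considered; \<open>vs\<close>, \<open>us\<close>, \<open>ps\<close> are the intermediate
  values of \<open>v\<close>, \<open>u\<close>, \<open>\<pi>\<close> on that side.\<close>

definition e_star :: "real \<Rightarrow> relax_state \<Rightarrow> real \<Rightarrow> real \<Rightarrow> real \<Rightarrow> real" where
  "e_star M W vs us ps =
     W_e M W + (ps\<^sup>2 - (W_pi W)\<^sup>2) / (2 * W_a W * W_b W)
       + (if W_a W = W_b W then 0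
          else M\<^sup>2 * ((vs - us)\<^sup>2 - (W_v W - W_u W)\<^sup>2) / (2 * (W_a W / W_b W - 1)))"

definition E_star :: "real \<Rightarrow> real \<Rightarrow> real \<Rightarrow> real \<Rightarrow> real" where
  "E_star M rs us es = rs * es + 1 / 2 * M\<^sup>2 * rs * us\<^sup>2"

definition star_flux :: "real \<Rightarrow> real \<Rightarrow> real \<Rightarrow> real \<Rightarrow> real \<Rightarrow> real \<Rightarrow> euler_state" where
  "star_flux M vs rs us ps Es = (rs * vs, rs * us * vs + ps / M\<^sup>2, (Es + ps) * vs)"

definition flux_L_star :: "real \<Rightarrow> real \<Rightarrow> relax_state \<Rightarrow> relax_state \<Rightarrow> euler_state" where
  "flux_L_star M d L R =
     (let vs = v_star M d L R; rs = rho_L_star M d L R; us = u_L_star M d L R;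
          ps = pi_L_star M d L R; es = e_star M L vs us ps
      in star_flux M vs rs us ps (E_star M rs us es))"

definition flux_R_star :: "real \<Rightarrow> real \<Rightarrow> relax_state \<Rightarrow> relax_state \<Rightarrow> euler_state" where
  "flux_R_star M d L R =
     (let vs = v_star M d L R; rs = rho_R_star M d L R; us = u_R_star M d L R;
          ps = pi_R_star M d L R; es = e_star M R vs us ps
      in star_flux M vs rs us ps (E_star M rs us es))"

definition sigma_minus :: "real \<Rightarrow> relax_state \<Rightarrow> real" where
  "sigma_minus M L = W_v L - W_a L / (M * W_rho L)"

definition sigma_plus :: "real \<Rightarrow> relax_state \<Rightarrow> real" where
  "sigma_plus M R = W_v R + W_a R / (M * W_rho R)"


text \<open>Relaxation speeds at an interface. A speed rule prescribes them from the data
  \<open>(\<omega>\<^sup>L, \<Phi>\<^sup>L, \<omega>\<^sup>R, \<Phi>\<^sup>R)\<close> there, so that fluxes and sources are functions of these data.\<close>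

record relax_speeds =
  a_L :: real
  b_L :: real
  a_R :: real
  b_R :: real

type_synonym speed_rule = "euler_state \<Rightarrow> real \<Rightarrow> euler_state \<Rightarrow> real \<Rightarrow> relax_speeds"

definition admissible_rule :: "real \<Rightarrow> speed_rule \<Rightarrow> bool" where
  "admissible_rule M s \<longleftrightarrow>
     (\<forall>wL\<in>phase_space M. \<forall>wR\<in>phase_space M. \<forall>\<phi>L \<phi>R.
        (let c = s wL \<phi>L wR \<phi>R
         in a_L c \<ge> b_L c \<and> b_L c > 0 \<and> a_R c \<ge> b_R c \<and> b_R c > 0))"

definition left_state ::
  "real \<Rightarrow> (real \<Rightarrow> real \<Rightarrow> real) \<Rightarrow> speed_rule \<Rightarrow>
   euler_state \<Rightarrow> real \<Rightarrow> euler_state \<Rightarrow> real \<Rightarrow> relax_state" where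
  "left_state M p s wL \<phi>L wR \<phi>R =
     equilibrium M p wL \<phi>L (a_L (s wL \<phi>L wR \<phi>R)) (b_L (s wL \<phi>L wR \<phi>R))"

definition right_state ::
  "real \<Rightarrow> (real \<Rightarrow> real \<Rightarrow> real) \<Rightarrow> speed_rule \<Rightarrow>
   euler_state \<Rightarrow> real \<Rightarrow> euler_state \<Rightarrow> real \<Rightarrow> relax_state" where
  "right_state M p s wL \<phi>L wR \<phi>R =
     equilibrium M p wR \<phi>R (a_R (s wL \<phi>L wR \<phi>R)) (b_R (s wL \<phi>L wR \<phi>R))"

text \<open>The flux is left unspecified for configurations of wave speeds outside the four cases
  (for instance \<open>\<sigma>\<^sup>- = 0\<close>).\<close>

definition num_flux ::
  "real \<Rightarrow> (real \<Rightarrow> real \<Rightarrow> real) \<Rightarrow> (relax_state \<Rightarrow> relax_state \<Rightarrow> real) \<Rightarrow> speed_rule \<Rightarrow>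
   euler_state \<Rightarrow> real \<Rightarrow> euler_state \<Rightarrow> real \<Rightarrow> euler_state" where
  "num_flux M p rbar s wL \<phi>L wR \<phi>R =
     (let L = left_state M p s wL \<phi>L wR \<phi>R;
          R = right_state M p s wL \<phi>L wR \<phi>R;
          d = gravity_jump rbar L R;
          sm = sigma_minus M L; sv = v_star M d L R; sp = sigma_plus M R
      in if sm > 0 then euler_flux M p wL
         else if sm < 0 \<and> 0 \<le> sv then flux_L_star M d L R
         else if sv < 0 \<and> 0 < sp then flux_R_star M d L R
         else if sp < 0 then euler_flux M p wR
         else undefined)"

text \<open>The scheme uses the convention \<open>sgn 0 = 1\<close>, unlike the library's \<^const>\<open>sgn\<close>.\<close>

definition sgn1 :: "real \<Rightarrow> real" where
  "sgn1 x = (if x < 0 then -1 else 1)"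

definition source_plus ::
  "real \<Rightarrow> (real \<Rightarrow> real \<Rightarrow> real) \<Rightarrow> (relax_state \<Rightarrow> relax_state \<Rightarrow> real) \<Rightarrow> speed_rule \<Rightarrow>
   euler_state \<Rightarrow> real \<Rightarrow> euler_state \<Rightarrow> real \<Rightarrow> euler_state" where
  "source_plus M p rbar s wL \<phi>L wR \<phi>R =
     (let L = left_state M p s wL \<phi>L wR \<phi>R;
          R = right_state M p s wL \<phi>L wR \<phi>R;
          vs = v_star M (gravity_jump rbar L R) L R
      in - (sgn1 vs + 1) *\<^sub>R (0, rbar L R / M\<^sup>2, rbar L R * vs))"

definition source_minus ::
  "real \<Rightarrow> (real \<Rightarrow> real \<Rightarrow> real) \<Rightarrow> (relax_state \<Rightarrow> relax_state \<Rightarrow> real) \<Rightarrow> speed_rule \<Rightarrow>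
   euler_state \<Rightarrow> real \<Rightarrow> euler_state \<Rightarrow> real \<Rightarrow> euler_state" where
  "source_minus M p rbar s wL \<phi>L wR \<phi>R =
     (let L = left_state M p s wL \<phi>L wR \<phi>R;
          R = right_state M p s wL \<phi>L wR \<phi>R;
          vs = v_star M (gravity_jump rbar L R) L R
      in (sgn1 vs - 1) *\<^sub>R (0, rbar L R / M\<^sup>2, rbar L R * vs))"

text \<open>One time step on the whole grid. \<open>s i\<close> is the speed rule of the interface \<open>i + 1/2\<close>
  between the cells \<open>i\<close> and \<open>i + 1\<close>.\<close>

definition scheme_step ::
  "real \<Rightarrow> (real \<Rightarrow> real \<Rightarrow> real) \<Rightarrow> (relax_state \<Rightarrow> relax_state \<Rightarrow> real) \<Rightarrow> (int \<Rightarrow> speed_rule) \<Rightarrow>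
   (int \<Rightarrow> real) \<Rightarrow> real \<Rightarrow> real \<Rightarrow> (int \<Rightarrow> euler_state) \<Rightarrow> int \<Rightarrow> euler_state" where
  "scheme_step M p rbar s \<Phi> dx dt w i =
     w i
     - (dt / dx) *\<^sub>R (num_flux M p rbar (s i) (w i) (\<Phi> i) (w (i + 1)) (\<Phi> (i + 1))
                     - num_flux M p rbar (s (i - 1)) (w (i - 1)) (\<Phi> (i - 1)) (w i) (\<Phi> i))
     + (dt / 2) *\<^sub>R
         (((\<Phi> i - \<Phi> (i - 1)) / dx) *\<^sub>R
            source_plus M p rbar (s (i - 1)) (w (i - 1)) (\<Phi> (i - 1)) (w i) (\<Phi> i)
          + ((\<Phi> (i + 1) - \<Phi> i) / dx) *\<^sub>R
            source_minus M p rbar (s i) (w i) (\<Phi> i) (w (i + 1)) (\<Phi> (i + 1)))"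

end

theory Submission
  imports Defs
begin

text \<open>The rest condition says \<open>\<pi>\<^sup>L - \<pi>\<^sup>R = \<Delta>\<close> at every interface. Hence \<open>v\<^sup>* = 0\<close> and
  \<open>\<pi>\<^sup>L\<^sup>* = \<pi>\<^sup>L\<close>, and \<open>\<sigma>\<^sup>- < 0 = \<sigma>\<^sup>v\<close> selects the flux \<open>F\<^sup>L\<^sup>*\<close>, which carries only the pressure
  of the left cell. By the convention \<open>sgn 0 = 1\<close> the whole source of an interface goes to the
  cell on its right, where it cancels the jump of these left pressures.\<close>

lemma equilibrium_primitives:
  assumes "dens w > 0"
  shows "W_pi (equilibrium M p w \<phi> a b) = pressure M p w"
    and "W_v (equilibrium M p w \<phi> a b) = vel w"
    and "W_Z (equilibrium M p w \<phi> a b) = \<phi>"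
  using assms by (simp_all add: equilibrium_def W_pi_def W_v_def W_Z_def)

context
  fixes M :: real and p :: "real \<Rightarrow> real \<Rightarrow> real"
    and rbar :: "relax_state \<Rightarrow> relax_state \<Rightarrow> real" and s :: speed_rule
    and wL wR :: euler_state and \<phi>L \<phi>R :: real and L R :: relax_state
  defines "L \<equiv> left_state M p s wL \<phi>L wR \<phi>R" and "R \<equiv> right_state M p s wL \<phi>L wR \<phi>R"
  assumes M: "M > 0"
    and rule: "admissible_rule M s"
    and Omega: "wL \<in> phase_space M" "wR \<in> phase_space M"
    and rest: "vel wL = 0" "vel wR = 0"
    and balance: "pressure M p wR - pressure M p wL + rbar L R * (\<phi>R - \<phi>L) = 0"
begin

lemma dens_pos: "dens wL > 0" "dens wR > 0"
  using Omega by (auto simp: phase_space_def)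

text \<open>The values of \<open>b\<close> keep the denominator \<open>W_b L + W_b R\<close> away
  from zero; \<open>W_a L\<close> gets its sign from \<open>a \<ge> b > 0\<close> and makes the left
  wave speed strictly negative.\<close>

lemma speeds_pos: "W_b L > 0" "W_b R > 0" "W_a L > 0"
proof -
  have "a_L (s wL \<phi>L wR \<phi>R) \<ge> b_L (s wL \<phi>L wR \<phi>R) \<and> b_L (s wL \<phi>L wR \<phi>R) > 0
      \<and> b_R (s wL \<phi>L wR \<phi>R) > 0"
    using rule Omega unfolding admissible_rule_def Let_def by blast
  then show "W_b L > 0" "W_b R > 0" "W_a L > 0"
    by (simp_all add: L_def R_def left_state_def right_state_def equilibrium_def)
qed

lemma interface_primitives:
  "W_pi L = pressure M p wL" "W_v L = 0" "W_Z L = \<phi>L"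
  "W_pi R = pressure M p wR" "W_v R = 0" "W_Z R = \<phi>R"
  using dens_pos rest
  by (simp_all add: L_def R_def left_state_def right_state_def equilibrium_primitives)

lemma gravity_jump_rest: "gravity_jump rbar L R = pressure M p wL - pressure M p wR"
  using balance by (simp add: gravity_jump_def interface_primitives)

lemma v_star_rest: "v_star M (gravity_jump rbar L R) L R = 0"
  unfolding v_star_def gravity_jump_rest by (simp add: interface_primitives)

text \<open>At rest the numerator is
  \<open>W_b R * W_pi L + W_b L * W_pi R + W_b L * (W_pi L - W_pi R)\<close>, which collapses to
  \<open>(W_b L + W_b R) * W_pi L\<close>.\<close>

lemma pi_L_star_rest: "pi_L_star M (gravity_jump rbar L R) L R = pressure M p wL"
  unfolding pi_L_star_def gravity_jump_rest using speeds_pos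
  by (simp add: interface_primitives field_simps)

text \<open>Strictness matters: at speed zero the case distinction in \<open>num_flux\<close> would
  not reach the left intermediate flux.\<close>

lemma sigma_minus_rest: "sigma_minus M L < 0"
proof -
  have "W_rho L = dens wL"
    by (simp add: L_def left_state_def equilibrium_def)
  then show ?thesis
    using M speeds_pos dens_pos by (simp add: sigma_minus_def interface_primitives)
qed

text \<open>Every term of \<open>star_flux\<close> except \<open>ps / M\<^sup>2\<close> carries the
  factor \<open>vs = 0\<close>, so the intermediate density, velocity and energy never have to be
  computed.\<close>

lemma num_flux_rest:
  "num_flux M p rbar s wL \<phi>L wR \<phi>R = (0, pressure M p wL / M\<^sup>2, 0)"
  using sigma_minus_rest
  by (simp add: num_flux_def Let_def v_star_rest flux_L_star_def star_flux_def pi_L_star_rest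
      flip: L_def R_def)

text \<open>The potential jump is multiplied in because the balance fixes only its product with
  \<open>rbar L R\<close>. The factor 2 is \<open>sgn1 0 + 1\<close>; it later meets the
  \<open>dt / 2\<close> of the scheme.\<close>

lemma source_plus_rest:
  "(\<phi>R - \<phi>L) *\<^sub>R source_plus M p rbar s wL \<phi>L wR \<phi>R
    = (0, 2 * (pressure M p wR - pressure M p wL) / M\<^sup>2, 0)"
proof -
  have "(\<phi>R - \<phi>L) * (- 2 * (rbar L R / M\<^sup>2)) = - 2 * (rbar L R * (\<phi>R - \<phi>L)) / M\<^sup>2"
    by simp
  also have "rbar L R * (\<phi>R - \<phi>L) = pressure M p wL - pressure M p wR"
    using balance by simp
  finally have "(\<phi>R - \<phi>L) * (- 2 * (rbar L R / M\<^sup>2))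
      = 2 * (pressure M p wR - pressure M p wL) / M\<^sup>2"
    by simp
  then show ?thesis
    by (simp add: source_plus_def Let_def v_star_rest sgn1_def flip: L_def R_def)
qed

lemma source_minus_rest: "source_minus M p rbar s wL \<phi>L wR \<phi>R = 0"
  by (simp add: source_minus_def Let_def v_star_rest sgn1_def zero_prod_def flip: L_def R_def)

end

lemma scheme_step_rest:
  fixes w :: "int \<Rightarrow> euler_state"
  assumes "M > 0" and dx: "dx > 0"
    and "\<And>i. admissible_rule M (s i)"
    and "\<And>i. w i \<in> phase_space M"
    and "\<And>i. vel (w i) = 0"
    and balance: "\<And>i. 1 / dx * (pressure M p (w (i + 1)) - pressure M p (w i))
             + rbar (left_state M p (s i) (w i) (\<Phi> i) (w (i + 1)) (\<Phi> (i + 1)))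
                    (right_state M p (s i) (w i) (\<Phi> i) (w (i + 1)) (\<Phi> (i + 1)))
               * ((\<Phi> (i + 1) - \<Phi> i) / dx) = 0"
  shows "scheme_step M p rbar s \<Phi> dx dt w i = w i"
proof -
  \<comment> \<open>The rest condition multiplied by \<open>dx\<close>, the form that the interface
    lemmas expect.\<close>
  have jump: "pressure M p (w (j + 1)) - pressure M p (w j)
             + rbar (left_state M p (s j) (w j) (\<Phi> j) (w (j + 1)) (\<Phi> (j + 1)))
                    (right_state M p (s j) (w j) (\<Phi> j) (w (j + 1)) (\<Phi> (j + 1)))
               * (\<Phi> (j + 1) - \<Phi> j) = 0" for j
    using balance[of j] dx by (simp flip: add_divide_distrib)
  have flux: "num_flux M p rbar (s j) (w j) (\<Phi> j) (w (j + 1)) (\<Phi> (j + 1))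
      = (0, pressure M p (w j) / M\<^sup>2, 0)" for j
    by (rule num_flux_rest; rule assms jump)
  have plus: "((\<Phi> i - \<Phi> (i - 1)) / dx) *\<^sub>R
        source_plus M p rbar (s (i - 1)) (w (i - 1)) (\<Phi> (i - 1)) (w i) (\<Phi> i)
      = (1 / dx) *\<^sub>R (0, 2 * (pressure M p (w i) - pressure M p (w (i - 1))) / M\<^sup>2, 0)"
  proof -
    have "(\<Phi> i - \<Phi> (i - 1)) *\<^sub>R
        source_plus M p rbar (s (i - 1)) (w (i - 1)) (\<Phi> (i - 1)) (w i) (\<Phi> i)
      = (0, 2 * (pressure M p (w i) - pressure M p (w (i - 1))) / M\<^sup>2, 0)"
      \<comment> \<open>The interface on the left of cell \<open>i\<close> has index
        \<open>i - 1\<close>, and \<open>i - 1 + 1\<close> must be rewritten to \<open>i\<close>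
        before the terms match.\<close>
      by (rule source_plus_rest; rule assms jump[of "i - 1", unfolded diff_add_cancel])
    from arg_cong[OF this, of "scaleR (1 / dx)"] show ?thesis
      by simp
  qed
  have minus: "source_minus M p rbar (s i) (w i) (\<Phi> i) (w (i + 1)) (\<Phi> (i + 1)) = 0"
    by (rule source_minus_rest; rule assms jump)
  show ?thesis
    \<comment> \<open>Unfolding \<open>flux\<close> reaches only the right interface; the left one
      is the instance \<open>i - 1\<close>, once simplified. In the momentum component,
      \<open>dt / dx\<close> times the jump of left pressures then cancels against the
      source.\<close>
    unfolding scheme_step_def plus minus flux using flux[of "i - 1"]
    by (cases "w i") (simp add: diff_divide_distrib right_diff_distrib)
qed

theorem theorem17:
  fixes M dx dt :: real
    and p :: "real \<Rightarrow> real \<Rightarrow> real"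
    and rbar :: "relax_state \<Rightarrow> relax_state \<Rightarrow> real"
    and s :: "int \<Rightarrow> speed_rule"
    and \<Phi> :: "int \<Rightarrow> real"
    and \<omega> :: "nat \<Rightarrow> int \<Rightarrow> euler_state"
  assumes "M > 0" and "dx > 0" and "dt > 0"
    and "density_average rbar"
    and "\<And>i. admissible_rule M (s i)"
    and "\<And>i. \<omega> 0 i \<in> phase_space M"
    and "\<And>n i. \<omega> (Suc n) i = scheme_step M p rbar s \<Phi> dx dt (\<omega> n) i"
    and "\<And>i. vel (\<omega> 0 i) = 0 \<and> vel (\<omega> 0 (i + 1)) = 0"
    and "\<And>i. 1 / dx * (pressure M p (\<omega> 0 (i + 1)) - pressure M p (\<omega> 0 i))
             + rbar (left_state M p (s i) (\<omega> 0 i) (\<Phi> i) (\<omega> 0 (i + 1)) (\<Phi> (i + 1)))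
                    (right_state M p (s i) (\<omega> 0 i) (\<Phi> i) (\<omega> 0 (i + 1)) (\<Phi> (i + 1)))
               * ((\<Phi> (i + 1) - \<Phi> i) / dx) = 0"
  shows "\<forall>n i. \<omega> (Suc n) i = \<omega> n i"
proof -
  have step: "scheme_step M p rbar s \<Phi> dx dt (\<omega> 0) i = \<omega> 0 i" for i
    by (rule scheme_step_rest; rule assms conjunct1[OF assms(8)])
  \<comment> \<open>Comparison with the initial slice rather than the preceding one: rest and
    balance are assumed at time 0 only, and equality carries them to all times.\<close>
  have "\<omega> n = \<omega> 0" for n
  proof (induction n)
    case (Suc n)
    show ?case
      by (rule ext) (simp only: assms(7) Suc step)
  qed simp
  then show ?thesis
    by (metis (no_types))
qed

end
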